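(* Let $(x_n)_{n\ge 0}$ be the stochastic approximation iterates $x_{n+1}=x_n+a(n)[h(x_n)+M_{n+1}]$ in $\mathbb R^d$, and let $V$ and $H$ be the Liapunov function and the compact set described in the context. Assume that the iterates $\{x_n\}$ are tight, and that for any bounded open set $B\subset\mathbb R^d$ with $H\subset B$, $$\mathbb P[x_n\rightarrow H\mid x_{n_0}\in B]\rightarrow 1\quad\text{as } n_0\rightarrow\infty .$$ Then almost surely $x_n\rightarrow H$ as $n\rightarrow\infty$.
   Context: Setting. $h:\mathbb R^d\to\mathbb R^d$ is Lipschitz. The step sizes $a(n)>0$ satisfy $\sum_n a(n)=\infty$, $\sum_n a(n)^2<\infty$, and there is $c>0$ with $a(n)\le c\,a(m)$ for all $n\ge m$. $(M_n)_{n\ge1}$ is an $\mathbb R^d$-valued square integrable martingale difference sequence with respect to $\mathcal F_n=\sigma(x_0,M_1,\ldots,M_n)$, i.e. $E[M_{n+1}\mid\mathcal F_n]=0$ a.s. for all $n\ge 0$, and $E[\|M_{n+1}\|^2\mid\mathcal F_n]\le c(1+\|x_n\|^2)$ a.s. for some $0<c<\infty$. $V:\mathbb R^d\to[0,\infty)$ is differentiable with $\lim_{\|x\|\uparrow\infty}V(x)=\infty$ and $\nabla V(x)\cdot h(x)\le 0$ for all $x$. $H:=\{x:\nabla V(x)\cdot h(x)=0\}$ is assumed to coincide with $\{x:V(x)=0\}$ (so $H$ is compact). $x_n\to H$ means that the distance from $x_n$ to $H$ tends to $0$. The iterates $\{x_n\}$ are tight if for every $\epsilon>0$ there is a compact $K\subset\mathbb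 R^d$ with $\mathbb P[x_n\in K]>1-\epsilon$ for all $n$. Conditional probabilities given an event are elementary ones, considered for those $n_0$ for which the conditioning event has positive probability. *)

theory Defs
  imports "HOL-Probability.Probability"
begin

text \<open>
  The library conditional expectation is real valued; for vectors it is taken coordinatewise
  with respect to the orthonormal basis. As for \<^const>\<open>real_cond_exp\<close>, the value is meaningful
  only for integrable \<open>f\<close> and is a version determined up to null sets.
\<close>

definition vec_cond_exp ::
  "'w measure \<Rightarrow> 'w measure \<Rightarrow> ('w \<Rightarrow> 'a::euclidean_space) \<Rightarrow> 'w \<Rightarrow> 'a"
  where "vec_cond_exp P F f \<omega> = (\<Sum>b\<in>Basis. real_cond_exp P F (\<lambda>w. f w \<bullet> b) \<omega> *\<^sub>R b)"

lemma vec_cond_exp_inner_Basis: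
  "b \<in> Basis \<Longrightarrow> vec_cond_exp P F f \<omega> \<bullet> b = real_cond_exp P F (\<lambda>w. f w \<bullet> b) \<omega>"
  by (simp add: vec_cond_exp_def)

text \<open>
  \<open>noise_filtration P X0 M n\<close> is the \<open>\<sigma>\<close>-algebra generated by \<open>X0, M 1, \<dots>, M n\<close>; the entry \<open>M 0\<close>
  is not used.
\<close>

definition noise_filtration ::
  "'w measure \<Rightarrow> ('w \<Rightarrow> 'a::topological_space) \<Rightarrow> (nat \<Rightarrow> 'w \<Rightarrow> 'a) \<Rightarrow> nat \<Rightarrow> 'w measure"
  where "noise_filtration P X0 M n =
    sigma (space P)
      ({X0 -` A \<inter> space P | A. A \<in> sets borel} \<union>
       {M k -` A \<inter> space P | k A. k \<in> {1..n} \<and> A \<in> sets borel})"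

lemma subalgebra_noise_filtration:
  assumes "X0 \<in> borel_measurable P" and "\<And>k. k \<ge> 1 \<Longrightarrow> M k \<in> borel_measurable P"
  shows "subalgebra P (noise_filtration P X0 M n)"
proof -
  let ?G = "{X0 -` A \<inter> space P | A. A \<in> sets borel} \<union>
       {M k -` A \<inter> space P | k A. k \<in> {1..n} \<and> A \<in> sets borel}"
  have G: "?G \<subseteq> sets P"
    using assms by (auto intro: measurable_sets)
  moreover have "?G \<subseteq> Pow (space P)" by auto
  ultimately show ?thesis
    unfolding subalgebra_def noise_filtration_def
    by (simp add: space_measure_of_conv sets.sigma_sets_subset)
qed

end

theory Submission
  imports Defs
begin

text \<open>
  Tightness supplies what the conditional hypothesis lacks. Let \<open>E\<close> be the event that the iterates
  approach \<open>H\<close>, and let \<open>\<epsilon> \<in> (0,1)\<close>. A compact set \<open>K\<close> carries more than \<open>1 - \<epsilon>\<close> of the mass of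
  every iterate, uniformly in the index, and \<open>H\<close> is bounded because \<open>V\<close> is coercive; hence one
  ball \<open>B\<close>, chosen before the index, contains both \<open>K\<close> and \<open>H\<close>. The event \<open>E\<close> does not depend on
  \<open>n\<^sub>0\<close>, so
  \<open>P(E) \<ge> P(E | x n\<^sub>0 \<in> B) P(x n\<^sub>0 \<in> B) \<ge> P(E | x n\<^sub>0 \<in> B) (1 - \<epsilon>)\<close>,
  whose right-hand side tends to \<open>1 - \<epsilon>\<close> as \<open>n\<^sub>0 \<rightarrow> \<infinity>\<close>
  (lemma \<open>prob_ge_if_cond_prob_tendsto_one\<close>). Letting \<open>\<epsilon> \<rightarrow> 0\<close> gives \<open>P(E) = 1\<close>.
\<close>

text \<open>
  Since \<open>\<epsilon> < 1\<close>, every conditioning event has positive probability, so the principal part of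
  the filter excludes no index.
\<close>

lemma (in prob_space) prob_ge_if_cond_prob_tendsto_one:
  assumes E: "{\<omega> \<in> space M. E \<omega>} \<in> events"
    and "\<epsilon> < 1"
    and Q: "\<And>n. 1 - \<epsilon> \<le> \<P>(\<omega> in M. Q n \<omega>)"
    and lim: "((\<lambda>n. \<P>(\<omega> in M. E \<omega> \<bar> Q n \<omega>)) \<longlongrightarrow> 1)
      (inf sequentially (principal {n. \<P>(\<omega> in M. Q n \<omega>) > 0}))"
  shows "1 - \<epsilon> \<le> \<P>(\<omega> in M. E \<omega>)"
proof -
  have pos: "\<P>(\<omega> in M. Q n \<omega>) > 0" for n
    using Q[of n] \<open>\<epsilon> < 1\<close> by linarith
  then have "(\<lambda>n. \<P>(\<omega> in M. E \<omega> \<bar> Q n \<omega>)) \<longlonglongrightarrow> 1"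
    using lim by simp
  then have "(\<lambda>n. \<P>(\<omega> in M. E \<omega> \<bar> Q n \<omega>) * (1 - \<epsilon>)) \<longlonglongrightarrow> 1 * (1 - \<epsilon>)"
    by (intro tendsto_mult tendsto_const)
  moreover have "\<P>(\<omega> in M. E \<omega> \<bar> Q n \<omega>) * (1 - \<epsilon>) \<le> \<P>(\<omega> in M. E \<omega>)" for n
  proof -
    have "\<P>(\<omega> in M. E \<omega> \<bar> Q n \<omega>) * (1 - \<epsilon>) \<le> \<P>(\<omega> in M. E \<omega> \<bar> Q n \<omega>) * \<P>(\<omega> in M. Q n \<omega>)"
      using Q by (intro mult_left_mono) (simp_all add: cond_prob_def)
    also have "\<dots> = \<P>(\<omega> in M. E \<omega> \<and> Q n \<omega>)"
      using pos[of n] by (simp add: cond_prob_def)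
    also have "\<dots> \<le> \<P>(\<omega> in M. E \<omega>)"
      using E by (intro finite_measure_mono) auto
    finally show ?thesis .
  qed
  ultimately show ?thesis
    by (intro LIMSEQ_le_const2[of _ "1 - \<epsilon>"]) auto
qed

lemma bounded_zeros_of_coercive:
  fixes V :: "'a::real_normed_vector \<Rightarrow> real"
  assumes "filterlim V at_top at_infinity"
  shows "bounded {y. V y = 0}"
proof -
  have "eventually (\<lambda>y. V y > 0) at_infinity"
    using assms by (simp add: filterlim_at_top_dense)
  then obtain b where b: "\<And>y. norm y \<ge> b \<Longrightarrow> V y > 0"
    by (auto simp: eventually_at_infinity)
  have "norm y \<le> b" if "V y = 0" for y
    using b[of y] that by (cases "norm y \<ge> b") auto
  then show ?thesis
    by (auto simp: bounded_iff)
qed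

theorem theorem1:
  fixes P :: "'w measure"
    and h :: "'a::euclidean_space \<Rightarrow> 'a"
    and a :: "nat \<Rightarrow> real"
    and x M :: "nat \<Rightarrow> 'w \<Rightarrow> 'a"
    and V :: "'a \<Rightarrow> real"
    and gradV :: "'a \<Rightarrow> 'a"
    and H :: "'a set"
  assumes "prob_space P"
    and h_lipschitz: "\<exists>L. L-lipschitz_on UNIV h"
    and a_pos: "\<And>n. a n > 0"
    and a_sum: "filterlim (\<lambda>n. \<Sum>k<n. a k) at_top sequentially"
    and a_square_sum: "summable (\<lambda>n. (a n)\<^sup>2)"
    and a_almost_decreasing: "\<exists>c>0. \<forall>m n. m \<le> n \<longrightarrow> a n \<le> c * a m"
    and x0_measurable: "x 0 \<in> borel_measurable P"
    and M_measurable: "\<And>n. n \<ge> 1 \<Longrightarrow> M n \<in> borel_measurable P"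
    and M_square_integrable: "\<And>n. n \<ge> 1 \<Longrightarrow> integrable P (\<lambda>\<omega>. (norm (M n \<omega>))\<^sup>2)"
    and M_martingale_difference:
      "\<And>n. AE \<omega> in P. vec_cond_exp P (noise_filtration P (x 0) M n) (M (n + 1)) \<omega> = 0"
    and M_conditional_variance:
      "\<exists>c>0. \<forall>n. AE \<omega> in P.
         real_cond_exp P (noise_filtration P (x 0) M n) (\<lambda>w. (norm (M (n + 1) w))\<^sup>2) \<omega>
           \<le> c * (1 + (norm (x n \<omega>))\<^sup>2)"
    and iterates:
      "\<And>n \<omega>. \<omega> \<in> space P \<Longrightarrow> x (n + 1) \<omega> = x n \<omega> + a n *\<^sub>R (h (x n \<omega>) + M (n + 1) \<omega>)"
    and V_nonneg: "\<And>y. V y \<ge> 0"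
    and V_gradient: "\<And>y. GDERIV V y :> gradV y"
    and V_coercive: "filterlim V at_top at_infinity"
    and V_liapunov: "\<And>y. gradV y \<bullet> h y \<le> 0"
    and H_def: "H = {y. gradV y \<bullet> h y = 0}"
    and H_zeros: "H = {y. V y = 0}"
    and tight: "\<forall>\<epsilon>>0. \<exists>K. compact K \<and> (\<forall>n. \<P>(\<omega> in P. x n \<omega> \<in> K) > 1 - \<epsilon>)"
    and local_convergence:
      "\<And>B. bounded B \<Longrightarrow> open B \<Longrightarrow> H \<subseteq> B \<Longrightarrow>
         ((\<lambda>n0. \<P>(\<omega> in P. (\<lambda>n. infdist (x n \<omega>) H) \<longlonglongrightarrow> 0 \<bar> x n0 \<omega> \<in> B)) \<longlongrightarrow> 1)
           (inf sequentially (principal {n0. \<P>(\<omega> in P. x n0 \<omega> \<in> B) > 0}))"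
  shows "AE \<omega> in P. (\<lambda>n. infdist (x n \<omega>) H) \<longlonglongrightarrow> 0"
proof -
  interpret prob_space P by fact
  have h_borel: "h \<in> borel_measurable borel"
    using h_lipschitz
    by (metis borel_measurable_continuous_onI lipschitz_on_continuous_on)
  have x_borel: "x n \<in> borel_measurable P" for n
  proof (induction n)
    case 0
    then show ?case by (fact x0_measurable)
  next
    case (Suc n)
    note [measurable] = Suc.IH M_measurable[of "n + 1", simplified] h_borel
    have "(\<lambda>\<omega>. x n \<omega> + a n *\<^sub>R (h (x n \<omega>) + M (n + 1) \<omega>)) \<in> borel_measurable P"
      by simp
    then show ?case
      using iterates[of _ n] by (subst measurable_cong) auto
  qed
  define E where "E \<omega> \<longleftrightarrow> (\<lambda>n. infdist (x n \<omega>) H) \<longlonglongrightarrow> 0" for \<omega>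
  have E_event: "{\<omega> \<in> space P. E \<omega>} \<in> events"
  proof -
    have [measurable]: "(\<lambda>\<omega>. infdist (x n \<omega>) H) \<in> borel_measurable P" for n
      using x_borel[of n]
      by (intro borel_measurable_continuous_on[where f = "\<lambda>y. infdist y H"])
        (intro continuous_on_infdist continuous_on_id, assumption)
    show ?thesis
      unfolding E_def by measurable
  qed
  have "bounded H"
    unfolding H_zeros using V_coercive by (rule bounded_zeros_of_coercive)
  have E_ge: "1 - \<epsilon> \<le> \<P>(\<omega> in P. E \<omega>)" if "0 < \<epsilon>" "\<epsilon> < 1" for \<epsilon>
  proof -
    obtain K where "compact K" and K: "\<And>n. \<P>(\<omega> in P. x n \<omega> \<in> K) > 1 - \<epsilon>"
      using tight \<open>0 < \<epsilon>\<close> by blast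
    have "bounded (K \<union> H)"
      using \<open>compact K\<close> \<open>bounded H\<close> by (simp add: compact_imp_bounded)
    then obtain r where r: "K \<union> H \<subseteq> ball 0 r"
      using bounded_subset_ballD by blast
    have "1 - \<epsilon> \<le> \<P>(\<omega> in P. x n \<omega> \<in> ball 0 r)" for n
    proof -
      have "{\<omega> \<in> space P. x n \<omega> \<in> ball 0 r} \<in> events"
        using measurable_sets[OF x_borel, of "ball 0 r" n]
        by (simp add: vimage_def Int_def conj_commute)
      then have "\<P>(\<omega> in P. x n \<omega> \<in> K) \<le> \<P>(\<omega> in P. x n \<omega> \<in> ball 0 r)"
        using r by (intro finite_measure_mono) auto
      with K[of n] show ?thesis by linarith
    qed
    moreover have "((\<lambda>n. \<P>(\<omega> in P. E \<omega> \<bar> x n \<omega> \<in> ball 0 r)) \<longlongrightarrow> 1)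
        (inf sequentially (principal {n. \<P>(\<omega> in P. x n \<omega> \<in> ball 0 r) > 0}))"
      unfolding E_def using r by (intro local_convergence) auto
    ultimately show ?thesis
      by (rule prob_ge_if_cond_prob_tendsto_one[OF E_event \<open>\<epsilon> < 1\<close>])
  qed
  have "\<P>(\<omega> in P. E \<omega>) = 1"
  proof (rule antisym)
    show "1 \<le> \<P>(\<omega> in P. E \<omega>)"
    proof (rule field_le_epsilon)
      fix \<epsilon> :: real
      assume "0 < \<epsilon>"
      then show "1 \<le> \<P>(\<omega> in P. E \<omega>) + \<epsilon>"
        using E_ge[of \<epsilon>] measure_nonneg[of P "{\<omega> \<in> space P. E \<omega>}"] by argo
    qed
  qed simp
  then show ?thesis
    using prob_Collect_eq_1[OF E_event] by (simp add: E_def)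
qed

end
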